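(* Let $d\in\mathbb{N}$ and let $T$ be a powerbounded $d\times d$ complex matrix. Then for every Banach limit $L$ one has $A_{T,C}=A_{T,L}$, i.e. the Cesàro asymptotic limit of $T$ exists and coincides with the $L$-asymptotic limit of $T$.
   Context: $\mathbb{C}^d$ carries the usual inner product; matrices are identified with operators on $\mathbb{C}^d$. A matrix $T$ is powerbounded if there is $M>0$ with $\|T^n\|<M$ for all $n\in\mathbb{N}=\{1,2,\dots\}$ (operator norm). A Banach limit is a bounded linear functional $L:\ell^\infty\to\mathbb{C}$ on bounded complex sequences such that $\|L\|=1$, $L(x)=\lim_n x_n$ for every convergent sequence $x$, $L$ is positive ($x_n\ge 0$ for all $n$ implies $L(x)\ge0$), and $L$ is shift-invariant ($L((x_n)_n)=L((x_{n+1})_n)$). For powerbounded $T$ and a Banach limit $L$, the $L$-asymptotic limit $A_{T,L}$ is the unique positive operator with $\langle A_{T,L}x,y\rangle = L\big((\langle T^nx,T^ny\rangle)_{n\ge1}\big)$ for all $x,y$ (for matrices: the entrywise $L$-limit of $T^{*n}T^n$). The Cesàro asymptotic limit of a matrix $T$ is $A_{T,C}=\lim_{n\to\infty}\frac1n\sum_{j=1}^n T^{*j}T^j$ (entrywise limit), if this limit exists. *)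

theory Defs
  imports "HOL-Analysis.Analysis"
begin

text \<open>
  The operator \<open>^\<close> on \<open>complex^'n^'n\<close> is the entrywise power, so powers of a matrix with respect
  to \<open>**\<close> are introduced here.
\<close>

primrec matrix_power :: "'a::semiring_1^'n^'n \<Rightarrow> nat \<Rightarrow> 'a^'n^'n" where
  "matrix_power A 0 = mat 1"
| "matrix_power A (Suc n) = A ** matrix_power A n"

definition conj_transpose :: "complex^'n^'m \<Rightarrow> complex^'m^'n" where
  "conj_transpose A = (\<chi> i j. cnj (A $ j $ i))"

text \<open>
  The library's \<open>x \<bullet> y\<close> on \<open>complex^'n\<close> is the real-valued product \<open>Re (cinner x y)\<close>.
\<close>

definition cinner :: "complex^'n \<Rightarrow> complex^'n \<Rightarrow> complex" where
  "cinner x y = (\<Sum>i\<in>UNIV. x $ i * cnj (y $ i))"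

definition positive_matrix :: "complex^'n^'n \<Rightarrow> bool" where
  "positive_matrix A \<longleftrightarrow> (\<forall>x. cinner (A *v x) x \<in> \<real>\<^sub>\<ge>\<^sub>0)"

definition powerbounded :: "complex^'n^'n \<Rightarrow> bool" where
  "powerbounded T \<longleftrightarrow> (\<exists>M>0. \<forall>n\<ge>1. onorm ((*v) (matrix_power T n)) < M)"


section \<open>Banach limits\<close>

text \<open>
  Since \<^typ>\<open>nat\<close> is discrete, \<^typ>\<open>nat \<Rightarrow>\<^sub>C complex\<close> is the space of all bounded complex sequences
  with the supremum norm.  A sequence \<open>(x\<^sub>n)\<close> with \<open>n \<ge> 1\<close> is represented by \<open>\<lambda>n. x\<^bsub>n+1\<^esub>\<close>.
\<close>

type_synonym linfty = "nat \<Rightarrow>\<^sub>C complex"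

lemma bcontfun_nat_iff: "(f :: nat \<Rightarrow> 'a::metric_space) \<in> bcontfun \<longleftrightarrow> bounded (range f)"
  by (simp add: bcontfun_def)

definition linfty_scale :: "complex \<Rightarrow> linfty \<Rightarrow> linfty" where
  "linfty_scale c x = Bcontfun (\<lambda>n. c * apply_bcontfun x n)"

definition linfty_shift :: "linfty \<Rightarrow> linfty" where
  "linfty_shift x = Bcontfun (\<lambda>n. apply_bcontfun x (Suc n))"

lemma linfty_scale_apply: "apply_bcontfun (linfty_scale c x) n = c * apply_bcontfun x n"
proof -
  have "bounded (range (\<lambda>n. c * apply_bcontfun x n))"
    using bounded_apply_bcontfun[of x] bounded_linear_image[OF _ bounded_linear_mult_right]
    by (metis image_image)
  then show ?thesis
    unfolding linfty_scale_def by (subst Bcontfun_inverse) (simp_all add: bcontfun_nat_iff)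
qed

lemma linfty_shift_apply: "apply_bcontfun (linfty_shift x) n = apply_bcontfun x (Suc n)"
proof -
  have "bounded (range (\<lambda>n. apply_bcontfun x (Suc n)))"
    by (rule bounded_subset[OF bounded_apply_bcontfun[of x]]) auto
  then show ?thesis
    unfolding linfty_shift_def by (subst Bcontfun_inverse) (simp_all add: bcontfun_nat_iff)
qed

text \<open>
  The predicate \<^const>\<open>bounded_linear\<close> only gives linearity over the reals.
\<close>

definition banach_limit :: "(linfty \<Rightarrow> complex) \<Rightarrow> bool" where
  "banach_limit L \<longleftrightarrow>
     bounded_linear L \<and> (\<forall>c x. L (linfty_scale c x) = c * L x) \<and>
     onorm L = 1 \<and>
     (\<forall>x l. apply_bcontfun x \<longlonglongrightarrow> l \<longrightarrow> L x = l) \<and>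
     (\<forall>x. (\<forall>n. apply_bcontfun x n \<in> \<real>\<^sub>\<ge>\<^sub>0) \<longrightarrow> L x \<in> \<real>\<^sub>\<ge>\<^sub>0) \<and>
     (\<forall>x. L (linfty_shift x) = L x)"


section \<open>Asymptotic limits\<close>

definition orbit_products :: "complex^'n^'n \<Rightarrow> complex^'n \<Rightarrow> complex^'n \<Rightarrow> linfty" where
  "orbit_products T x y =
     Bcontfun (\<lambda>n. cinner (matrix_power T (Suc n) *v x) (matrix_power T (Suc n) *v y))"

definition is_asymptotic_limit ::
    "(linfty \<Rightarrow> complex) \<Rightarrow> complex^'n^'n \<Rightarrow> complex^'n^'n \<Rightarrow> bool" where
  "is_asymptotic_limit L T A \<longleftrightarrow>
     positive_matrix A \<and> (\<forall>x y. cinner (A *v x) y = L (orbit_products T x y))"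

definition asymptotic_limit :: "(linfty \<Rightarrow> complex) \<Rightarrow> complex^'n^'n \<Rightarrow> complex^'n^'n" where
  "asymptotic_limit L T = (THE A. is_asymptotic_limit L T A)"

definition cesaro_mean :: "complex^'n^'n \<Rightarrow> nat \<Rightarrow> complex^'n^'n" where
  "cesaro_mean T n =
     (1 / real n) *\<^sub>R (\<Sum>j=1..n. matrix_power (conj_transpose T) j ** matrix_power T j)"

text \<open>
  The topology of \<open>complex^'n^'n\<close> is the product topology, so this is an entrywise limit.
\<close>

definition cesaro_asymptotic_limit :: "complex^'n^'n \<Rightarrow> complex^'n^'n" where
  "cesaro_asymptotic_limit T = lim (cesaro_mean T)"


subsection \<open>Well-definedness of the asymptotic limit\<close>

lemma cinner_add_left: "cinner (x + y) z = cinner x z + cinner y z"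
  by (simp add: cinner_def algebra_simps sum.distrib)

lemma cinner_add_right: "cinner z (x + y) = cinner z x + cinner z y"
  by (simp add: cinner_def algebra_simps sum.distrib)

lemma cinner_scale_left: "cinner (c *s x) y = c * cinner x y"
  by (simp add: cinner_def sum_distrib_left mult_ac)

lemma cinner_scale_right: "cinner x (c *s y) = cnj c * cinner x y"
  by (simp add: cinner_def sum_distrib_left mult_ac)

lemma cinner_axis_right: "cinner x (axis i 1) = x $ i"
proof -
  have "x $ j * cnj (axis i 1 $ j) = (if j = i then x $ j else 0)" for j
    by (simp add: axis_def)
  then show ?thesis by (simp add: cinner_def)
qed

lemma cinner_self: "cinner x x = of_real ((norm x)\<^sup>2)"
  by (simp add: cinner_def norm_vec_def L2_set_def sum_nonneg flip: complex_norm_square)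

lemma norm_cinner_le: "norm (cinner x y) \<le> norm x * norm y"
proof -
  have "norm (cinner x y) \<le> (\<Sum>i\<in>UNIV. \<bar>norm (x $ i)\<bar> * \<bar>norm (y $ i)\<bar>)"
    unfolding cinner_def by (rule order_trans[OF norm_sum]) (simp add: norm_mult)
  also have "\<dots> \<le> norm x * norm y"
    unfolding norm_vec_def by (rule L2_set_mult_ineq)
  finally show ?thesis .
qed

lemma orbit_products_apply:
  assumes "powerbounded T"
  shows "apply_bcontfun (orbit_products T x y) n =
           cinner (matrix_power T (Suc n) *v x) (matrix_power T (Suc n) *v y)"
proof -
  obtain M where M: "M > 0" "\<And>n. n \<ge> 1 \<Longrightarrow> onorm ((*v) (matrix_power T n)) < M"
    using assms by (auto simp: powerbounded_def)
  have bl: "bounded_linear ((*v) A)" for A :: "complex^'n^'n"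
    by (rule matrix_vector_mul_bounded_linear)
  have b: "norm (matrix_power T (Suc n) *v z) \<le> M * norm z" for n z
    using M(2)[of "Suc n"]
    by (intro order_trans[OF onorm[OF bl]] mult_right_mono) simp_all
  have "norm (cinner (matrix_power T (Suc n) *v x) (matrix_power T (Suc n) *v y))
          \<le> (M * norm x) * (M * norm y)" for n
    using M(1)
    by (intro order_trans[OF norm_cinner_le] mult_mono b mult_nonneg_nonneg) auto
  then have "bounded (range (\<lambda>n. cinner (matrix_power T (Suc n) *v x) (matrix_power T (Suc n) *v y)))"
    by (auto simp: bounded_iff)
  then show ?thesis
    unfolding orbit_products_def by (subst Bcontfun_inverse) (simp_all add: bcontfun_nat_iff)
qed

lemma is_asymptotic_limit_ex1:
  fixes T :: "complex^'n^'n"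
  assumes T: "powerbounded T" and L: "banach_limit L"
  shows "\<exists>!A. is_asymptotic_limit L T A"
proof -
  note ap = orbit_products_apply[OF T]
  interpret L: bounded_linear L using L by (simp add: banach_limit_def)
  have Lc: "L (linfty_scale c x) = c * L x" for c x using L by (simp add: banach_limit_def)
  define B where "B x y = L (orbit_products T x y)" for x y
  have addl: "B (x + y) z = B x z + B y z" for x y z
  proof -
    have "orbit_products T (x + y) z = orbit_products T x z + orbit_products T y z"
      by (rule bcontfun_eqI) (simp add: ap matrix_vector_right_distrib cinner_add_left)
    then show ?thesis by (simp add: B_def L.add)
  qed
  have addr: "B z (x + y) = B z x + B z y" for x y z
  proof -
    have "orbit_products T z (x + y) = orbit_products T z x + orbit_products T z y"
      by (rule bcontfun_eqI) (simp add: ap matrix_vector_right_distrib cinner_add_right)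
    then show ?thesis by (simp add: B_def L.add)
  qed
  have scl: "B (c *s x) y = c * B x y" for c x y
  proof -
    have "orbit_products T (c *s x) y = linfty_scale c (orbit_products T x y)"
      by (rule bcontfun_eqI)
         (simp add: ap linfty_scale_apply vector_scalar_commute cinner_scale_left)
    then show ?thesis by (simp add: B_def Lc)
  qed
  have scr: "B x (c *s y) = cnj c * B x y" for c x y
  proof -
    have "orbit_products T x (c *s y) = linfty_scale (cnj c) (orbit_products T x y)"
      by (rule bcontfun_eqI)
         (simp add: ap linfty_scale_apply vector_scalar_commute cinner_scale_right)
    then show ?thesis by (simp add: B_def Lc)
  qed
  have zl: "B 0 y = 0" and zr: "B x 0 = 0" for x y
    using scl[of 0 0 y] scr[of x 0 0] by simp_all
  have suml: "B (sum f I) y = (\<Sum>i\<in>I. B (f i) y)" for f y and I :: "'n set"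
    by (induction I rule: infinite_finite_induct) (simp_all add: zl addl)
  have sumr: "B y (sum f I) = (\<Sum>i\<in>I. B y (f i))" for f y and I :: "'n set"
    by (induction I rule: infinite_finite_induct) (simp_all add: zr addr)
  define A :: "complex^'n^'n" where "A = (\<chi> i j. B (axis j 1) (axis i 1))"
  have A: "cinner (A *v x) y = B x y" for x y
  proof -
    have "B x y = B (\<Sum>j\<in>UNIV. x $ j *s axis j 1) (\<Sum>i\<in>UNIV. y $ i *s axis i 1)"
      by (simp add: basis_expansion)
    also have "\<dots> = (\<Sum>i\<in>UNIV. \<Sum>j\<in>UNIV. cnj (y $ i) * (x $ j * B (axis j 1) (axis i 1)))"
      by (simp add: suml sumr scl scr sum_distrib_left)
    also have "\<dots> = cinner (A *v x) y"
      by (simp add: cinner_def A_def matrix_vector_mult_def sum_distrib_left mult_ac)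
    finally show ?thesis by simp
  qed
  have pos: "B x x \<in> \<real>\<^sub>\<ge>\<^sub>0" for x
  proof -
    have "\<forall>n. apply_bcontfun (orbit_products T x x) n \<in> \<real>\<^sub>\<ge>\<^sub>0"
      by (simp add: ap cinner_self)
    then show ?thesis using L unfolding B_def banach_limit_def by blast
  qed
  show ?thesis
  proof (rule ex1I[of _ A])
    show "is_asymptotic_limit L T A"
      by (simp add: is_asymptotic_limit_def positive_matrix_def A pos flip: B_def)
  next
    fix A' assume "is_asymptotic_limit L T A'"
    then have "cinner (A' *v x) y = cinner (A *v x) y" for x y
      by (simp add: is_asymptotic_limit_def A flip: B_def)
    from this[of _ "axis _ 1"] have "A' *v x = A *v x" for x
      by (simp add: cinner_axis_right vec_eq_iff)
    then show "A' = A" by (simp add: matrix_eq)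
  qed
qed

end

theory Submission
  imports Defs
begin

text \<open>
  The map \<open>f X = T\<^sup>* X T\<close> is a linear map with bounded orbits on the finite-dimensional space of
  matrices, so (as in the mean ergodic theorem) every matrix is the sum of a fixed point of \<open>f\<close> and
  a coboundary.  Write \<open>1 = P + (Y - f Y)\<close> with \<open>f P = P\<close>.  Then
  \<open>T\<^sup>*\<^sup>n T\<^sup>n = P + f\<^sup>n Y - f\<^sup>n\<^sup>+\<^sup>1 Y\<close>: the Cesaro means telescope to \<open>P\<close>, and a
  Banach limit, being shift-invariant, does not see the coboundary and also gives \<open>P\<close>.
\<close>

section \<open>The ergodic decomposition in finite dimension\<close>

text \<open>If \<open>z = y - f y\<close> is fixed, each application of \<open>f\<close> subtracts
  another \<open>z\<close>, so the orbit of \<open>y\<close> drifts linearly and stays bounded only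
  when \<open>z = 0\<close>.\<close>

lemma fixed_coboundary_eq_0:
  fixes f :: "'a::euclidean_space \<Rightarrow> 'a"
  assumes f: "linear f"
    and bdd: "bounded (range (\<lambda>n. (f ^^ n) y))"
    and fixed: "f (y - f y) = y - f y"
  shows "y - f y = 0"
proof -
  let ?z = "y - f y"
  have "(f ^^ n) y = y - real n *\<^sub>R ?z" for n
  proof (induction n)
    case (Suc n)
    have "(f ^^ Suc n) y = f y - real n *\<^sub>R f ?z"
      using f by (simp add: Suc linear_diff linear_scale)
    also have "\<dots> = y - real (Suc n) *\<^sub>R ?z"
      unfolding fixed by (simp add: algebra_simps)
    finally show ?case .
  qed simp
  then obtain C where C: "norm (y - real n *\<^sub>R ?z) \<le> C" for n
    using bdd by (auto simp: bounded_iff)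
  have "real n * norm ?z \<le> norm y + C" for n
    using norm_triangle_ineq4[of y "y - real n *\<^sub>R ?z"] C[of n] by simp
  then have "\<not> 0 < norm ?z"
    by (metis reals_Archimedean3 not_le)
  then show ?thesis by simp
qed

text \<open>With \<open>g = id - f\<close>, the kernel and the range of \<open>g\<close> meet only
  in 0. In finite dimension \<open>g\<close> therefore maps its range onto itself, which allows
  \<open>x\<close> to be corrected by an element of the range until it lies in the kernel.\<close>

lemma ergodic_decomposition:
  fixes f :: "'a::euclidean_space \<Rightarrow> 'a"
  assumes f: "linear f"
    and bdd: "\<And>y. bounded (range (\<lambda>n. (f ^^ n) y))"
  obtains p y where "f p = p" "x = p + (y - f y)"
proof -
  define g where "g y = y - f y" for y
  have g: "linear g"
    unfolding g_def using f by (intro linear_compose_sub linear_id[unfolded id_def])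
  let ?R = "range g"
  have R: "subspace ?R"
    using g by (simp add: linear_subspace_image)
  have "z = 0" if "z \<in> ?R" "g z = 0" for z
    using that fixed_coboundary_eq_0[OF f bdd] by (auto simp: g_def)
  then have "inj_on g (span ?R)"
    using g R by (simp add: linear_injective_on_subspace_0 span_eq_iff[THEN iffD2])
  then have "dim (g ` ?R) = dim ?R"
    by (rule dim_image_eq[OF g])
  \<comment> \<open>The image is a subspace of \<open>?R\<close> of the same dimension.\<close>
  then have "g ` ?R = ?R"
    using R g by (intro subspace_dim_equal) (auto simp: linear_subspace_image)
  then obtain y where y: "g x = g (g y)"
    by blast
  show thesis
  proof
    show "f (x - g y) = x - g y"
      using y linear_diff[OF g, of x "g y"] g_def[of "x - g y"] by simp
    show "x = x - g y + (y - f y)"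
      by (simp add: g_def)
  qed
qed

lemma cesaro_fixed_plus_coboundary:
  fixes s :: "nat \<Rightarrow> 'a::real_normed_vector"
  assumes "bounded (range s)"
  shows "(\<lambda>n. (1 / real n) *\<^sub>R (\<Sum>j=1..n. p + (s j - s (Suc j)))) \<longlonglongrightarrow> p"
proof -
  obtain C where C: "norm (s n) \<le> C" for n
    using assms by (auto simp: bounded_iff)
  have sum: "(\<Sum>j=1..n. p + (s j - s (Suc j))) = real n *\<^sub>R p + (s 1 - s (Suc n))" for n
    by (induction n) (simp_all add: algebra_simps)
  have "(\<lambda>n. (1 / real n) *\<^sub>R (s 1 - s (Suc n))) \<longlonglongrightarrow> 0"
  proof (rule tendsto_0_le)
    show "(\<lambda>n. 1 / real n) \<longlonglongrightarrow> 0"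
      by (rule lim_1_over_n)
    have "norm (s 1 - s (Suc n)) \<le> 2 * C" for n
      using norm_triangle_ineq4[of "s 1" "s (Suc n)"] C[of 1] C[of "Suc n"] by linarith
    then show "\<forall>\<^sub>F n in sequentially.
        norm ((1 / real n) *\<^sub>R (s 1 - s (Suc n))) \<le> norm (1 / real n) * (2 * C)"
      by (intro always_eventually allI) (simp add: divide_right_mono)
  qed
  then have "(\<lambda>n. p + (1 / real n) *\<^sub>R (s 1 - s (Suc n))) \<longlonglongrightarrow> p"
    using tendsto_add[OF tendsto_const, of _ 0] by fastforce
  then show ?thesis
    \<comment> \<open>The two sequences agree only from 1 on: at 0 the mean is 0 and the other term
      is \<open>p\<close>.\<close>
    by (rule Lim_transform_eventually, intro eventually_sequentiallyI[of 1])
       (simp add: sum[unfolded One_nat_def] scaleR_add_right)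
qed


section \<open>Matrices\<close>

lemma matrix_eq_cinnerI:
  assumes "\<And>x y. cinner (A *v x) y = cinner (B *v x) y"
  shows "A = B"
  using assms[of _ "axis _ 1"] by (simp add: matrix_eq vec_eq_iff cinner_axis_right)

text \<open>The entries are values of the sesquilinear form at basis vectors, and there are finitely
  many of them.\<close>

lemma bounded_range_matrixI:
  fixes A :: "'k \<Rightarrow> complex^'n^'n"
  assumes "\<And>x y. bounded (range (\<lambda>k. cinner (A k *v x) y))"
  shows "bounded (range A)"
proof -
  have "A k $ i $ j = cinner (A k *v axis j 1) (axis i 1)" for k i j
    unfolding cinner_axis_right
    by (simp add: matrix_vector_mult_def axis_def if_distrib cong: if_cong)
  then have "\<exists>C. \<forall>k. norm (A k $ i $ j) \<le> C" for i j
    using assms[of "axis j 1" "axis i 1"] by (auto simp: bounded_iff)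
  then obtain C where C: "norm (A k $ i $ j) \<le> C i j" for k i j
    by metis
  have "norm (A k) \<le> (\<Sum>i\<in>UNIV. \<Sum>j\<in>UNIV. C i j)" for k
  proof -
    have "norm (A k) \<le> (\<Sum>i\<in>UNIV. norm (A k $ i))"
      by (simp add: norm_vec_def L2_set_le_sum)
    also have "\<dots> \<le> (\<Sum>i\<in>UNIV. \<Sum>j\<in>UNIV. norm (A k $ i $ j))"
      by (intro sum_mono) (simp add: norm_vec_def L2_set_le_sum)
    also have "\<dots> \<le> (\<Sum>i\<in>UNIV. \<Sum>j\<in>UNIV. C i j)"
      by (intro sum_mono C)
    finally show ?thesis .
  qed
  then show ?thesis
    by (auto simp: bounded_iff)
qed

lemma cinner_conj_transpose: "cinner (conj_transpose A *v x) y = cinner x (A *v y)"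
proof -
  have "cinner (conj_transpose A *v x) y
      = (\<Sum>i\<in>UNIV. \<Sum>j\<in>UNIV. x $ j * (cnj (A $ j $ i) * cnj (y $ i)))"
    by (simp add: cinner_def conj_transpose_def matrix_vector_mult_def sum_distrib_left sum_distrib_right mult_ac)
  also have "\<dots> = cinner x (A *v y)"
    by (subst sum.swap)
       (simp add: cinner_def matrix_vector_mult_def sum_distrib_left)
  finally show ?thesis .
qed

lemma matrix_power_mult_commute: "matrix_power A n ** A = A ** matrix_power A n"
  by (induction n) (simp_all flip: matrix_mul_assoc)

lemma cinner_conj_transpose_power:
  "cinner (matrix_power (conj_transpose A) n *v x) y = cinner x (matrix_power A n *v y)"
proof (induction n arbitrary: y)
  case (Suc n)
  have "cinner (matrix_power (conj_transpose A) (Suc n) *v x) y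
      = cinner x (matrix_power A n *v (A *v y))"
    by (simp add: cinner_conj_transpose Suc flip: matrix_vector_mul_assoc)
  \<comment> \<open>The adjoint reverses the product, giving \<open>matrix_power A n ** A\<close>,
    while \<open>matrix_power\<close> multiplies on the left.\<close>
  then show ?case
    by (simp add: matrix_vector_mul_assoc matrix_power_mult_commute)
qed simp

definition conjugation :: "complex^'n^'n \<Rightarrow> complex^'n^'n \<Rightarrow> complex^'n^'n" where
  "conjugation T X = conj_transpose T ** X ** T"

lemma cinner_conjugation: "cinner (conjugation T X *v x) y = cinner (X *v (T *v x)) (T *v y)"
  by (simp add: conjugation_def cinner_conj_transpose flip: matrix_vector_mul_assoc)

lemma linear_conjugation: "linear (conjugation T)"
proof (rule linearI)
  show "conjugation T (X + Y) = conjugation T X + conjugation T Y" for X Y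
    by (rule matrix_eq_cinnerI)
       (simp add: cinner_conjugation matrix_vector_mult_add_rdistrib cinner_add_left)
  \<comment> \<open>Linearity is over the reals, whereas \<open>cinner_scale_left\<close> expects a
    complex scalar.\<close>
  have scale: "(c *\<^sub>R X) *v x = complex_of_real c *s (X *v x)" for c and X :: "complex^'n^'n" and x
    by (simp add: vec_eq_iff matrix_vector_mult_def sum_distrib_left scaleR_conv_of_real[where 'a = complex] mult_ac)
  show "conjugation T (c *\<^sub>R X) = c *\<^sub>R conjugation T X" for c X
    by (rule matrix_eq_cinnerI) (simp add: cinner_conjugation scale cinner_scale_left)
qed

lemma cinner_conjugation_power:
  "cinner ((conjugation T ^^ n) X *v x) y
     = cinner (X *v (matrix_power T n *v x)) (matrix_power T n *v y)"
proof (induction n arbitrary: X)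
  case (Suc n)
  have "cinner ((conjugation T ^^ Suc n) X *v x) y
      = cinner ((conjugation T ^^ n) (conjugation T X) *v x) y"
    by (simp add: funpow_swap1)
  also have "\<dots> = cinner (X *v (matrix_power T (Suc n) *v x)) (matrix_power T (Suc n) *v y)"
    by (simp add: Suc cinner_conjugation flip: matrix_vector_mul_assoc)
  finally show ?case .
qed simp

text \<open>This identifies the summands of \<open>cesaro_mean\<close> as the orbit of the identity
  under conjugation.\<close>

lemma conjugation_power_one:
  "(conjugation T ^^ n) (mat 1) = matrix_power (conj_transpose T) n ** matrix_power T n"
  by (rule matrix_eq_cinnerI)
     (simp add: cinner_conjugation_power cinner_conj_transpose_power flip: matrix_vector_mul_assoc)

lemma powerbounded_bound:
  assumes "powerbounded T"
  obtains M where "M \<ge> 0" "\<And>n x. norm (matrix_power T n *v x) \<le> M * norm x"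
proof -
  obtain M where M: "\<And>n. n \<ge> 1 \<Longrightarrow> onorm ((*v) (matrix_power T n)) < M"
    using assms by (auto simp: powerbounded_def)
  \<comment> \<open>The 1 covers \<open>n = 0\<close>, where the power is the identity and
    \<open>powerbounded\<close> gives no bound.\<close>
  have "norm (matrix_power T n *v x) \<le> max 1 M * norm x" for n x
  proof (cases "n = 0")
    case True
    then show ?thesis
      using mult_right_mono[of 1 "max 1 M" "norm x"] by simp
  next
    case False
    then have "onorm ((*v) (matrix_power T n)) \<le> max 1 M"
      using M[of n] by simp
    then show ?thesis
      by (intro order_trans[OF onorm[OF matrix_vector_mul_bounded_linear]] mult_right_mono) simp_all
  qed
  then show thesis
    by (intro that[of "max 1 M"]) simp_all
qed

lemma bounded_cinner_conjugation_power:
  assumes "powerbounded T"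
  shows "bounded (range (\<lambda>n. cinner ((conjugation T ^^ n) X *v x) y))"
proof -
  obtain M where M: "M \<ge> 0" "\<And>n x. norm (matrix_power T n *v x) \<le> M * norm x"
    using powerbounded_bound[OF assms] by blast
  obtain K where K: "K \<ge> 0" "\<And>z. norm (X *v z) \<le> norm z * K"
    using bounded_linear.nonneg_bounded[OF matrix_vector_mul_bounded_linear[of X]] by blast
  have "norm (cinner ((conjugation T ^^ n) X *v x) y) \<le> (M * norm x * K) * (M * norm y)" for n
    unfolding cinner_conjugation_power
    using M K
    by (intro order_trans[OF norm_cinner_le] mult_mono order_trans[OF K(2)] mult_right_mono) auto
  then show ?thesis
    by (auto simp: bounded_iff)
qed


section \<open>Banach limits\<close>

lemma banach_limit_coboundary:
  assumes L: "banach_limit L" and s: "bounded (range s)"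
    and u: "\<And>n. apply_bcontfun u n = c + (s n - s (Suc n))"
  shows "L u = c"
proof -
  interpret L: bounded_linear L using L by (simp add: banach_limit_def)
  define v where "v = Bcontfun s"
  have v: "apply_bcontfun v n = s n" for n
    using s unfolding v_def by (subst Bcontfun_inverse) (simp_all add: bcontfun_nat_iff)
  \<comment> \<open>Adding back the coboundary leaves the constant sequence \<open>c\<close>; by
    shift-invariance the added part has Banach limit 0.\<close>
  have "apply_bcontfun (u - v + linfty_shift v) \<longlonglongrightarrow> c"
    by (simp add: u v linfty_shift_apply)
  then have "L (u - v + linfty_shift v) = c"
    using L unfolding banach_limit_def by blast
  moreover have "L (linfty_shift v) = L v"
    using L unfolding banach_limit_def by blast
  ultimately show ?thesis
    by (simp add: L.add L.diff)
qed

theorem theorem1: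
  fixes T :: "complex^'n^'n"
  assumes "powerbounded T"
  shows "convergent (cesaro_mean T) \<and>
         (\<forall>L. banach_limit L \<longrightarrow> cesaro_asymptotic_limit T = asymptotic_limit L T)"
proof -
  let ?f = "conjugation T"
  note bdd = bounded_cinner_conjugation_power[OF assms]
  have bddm: "bounded (range (\<lambda>n. (?f ^^ n) X))" for X
    by (rule bounded_range_matrixI) (rule bdd)
  obtain P Y where P: "?f P = P" and decomp: "mat 1 = P + (Y - ?f Y)"
    using ergodic_decomposition[OF linear_conjugation bddm] .
  have lin: "linear (?f ^^ n)" for n
  proof (induction n)
    case (Suc n)
    then show ?case
      unfolding funpow.simps by (rule linear_compose[OF _ linear_conjugation])
  qed (simp add: linear_id[unfolded id_def] id_def)
  \<comment> \<open>Apply the n-th iterate of \<open>?f\<close> to the decomposition of the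
    identity; \<open>P\<close> is unchanged.\<close>
  have orbit: "(?f ^^ n) (mat 1) = P + ((?f ^^ n) Y - (?f ^^ Suc n) Y)" for n
  proof -
    have "(?f ^^ n) P = P"
      by (induction n) (simp_all add: P)
    then show ?thesis
      unfolding decomp by (simp add: linear_add[OF lin] linear_diff[OF lin] funpow_swap1)
  qed
  have lim: "cesaro_mean T \<longlonglongrightarrow> P"
    using cesaro_fixed_plus_coboundary[OF bddm[of Y], of P]
    by (simp add: cesaro_mean_def[abs_def] orbit del: funpow.simps flip: conjugation_power_one)
  have "asymptotic_limit L T = P" if L: "banach_limit L" for L
  proof (rule matrix_eq_cinnerI)
    fix x y
    \<comment> \<open>The iterate is \<open>Suc n\<close> because index \<open>n\<close> of
      \<open>orbit_products\<close> holds the power \<open>n + 1\<close>.\<close>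
    let ?s = "\<lambda>n. cinner ((?f ^^ Suc n) Y *v x) y"
    have "apply_bcontfun (orbit_products T x y) n = cinner (P *v x) y + (?s n - ?s (Suc n))" for n
    proof -
      have diff: "cinner (a - b) y = cinner a y - cinner b y" for a b
        using cinner_add_left[of "a - b" b y] by simp
      have "apply_bcontfun (orbit_products T x y) n = cinner ((?f ^^ Suc n) (mat 1) *v x) y"
        unfolding orbit_products_apply[OF assms] cinner_conjugation_power by simp
      then show ?thesis
        unfolding orbit
        by (simp add: matrix_vector_mult_add_rdistrib matrix_vector_mult_diff_rdistrib
              cinner_add_left diff del: funpow.simps)
    qed
    moreover have "bounded (range ?s)"
      by (rule bounded_subset[OF bdd[of Y x y]]) (auto simp del: funpow.simps)
    ultimately have "L (orbit_products T x y) = cinner (P *v x) y"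
      by (rule banach_limit_coboundary[OF L, rotated])
    moreover have "is_asymptotic_limit L T (asymptotic_limit L T)"
      unfolding asymptotic_limit_def by (rule theI') (rule is_asymptotic_limit_ex1[OF assms L])
    ultimately show "cinner (asymptotic_limit L T *v x) y = cinner (P *v x) y"
      by (simp add: is_asymptotic_limit_def)
  qed
  then show ?thesis
    using lim by (auto simp: convergent_def cesaro_asymptotic_limit_def limI)
qed

end
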